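(* Let $\mathcal L$ be a proto-Lagrangian. Suppose that for some linear $K:\mathbb C^{r\times c}\to\mathbb C^{r\times c}$ and some $A=[A^\alpha_\beta]\in\mathbb R^{N\times N}$ with $\mathrm{Tr}\,A=0$ the following hold for all $P,Q_1,\dots,Q_N\in\mathbb C^{r\times c}$, all $x\in\mathbb R^N$ and $s\in\mathbb R$ with $|s|$ small. Let $\mathbb L$ be the linear map on $N$-tuples $Q=(Q_1,\dots,Q_N)$ of matrices in $\mathbb C^{r\times c}$ given by $(\mathbb LQ)_\mu=KQ_\mu+\sum_{\lambda=1}^NA^\lambda_\mu Q_\lambda$. (internal symmetry) $$\mathcal L\big(e^{sK}P;(e^{sK}P)^\dagger;\dots,(e^{s\mathbb L}Q)_\mu,\dots;\dots,((e^{s\mathbb L}Q)_\mu)^\dagger,\dots;x\big)=\mathcal L\big(P;P^\dagger;\dots,Q_\mu,\dots;\dots,Q_\mu^\dagger,\dots;x\big)+O(s^2);$$ (external symmetry) $$\mathcal L\big(P;P^\dagger;\dots,Q_\mu,\dots;\dots,Q_\mu^\dagger,\dots;e^{sA}x\big)=\mathcal L\big(P;P^\dagger;\dots,Q_\mu,\dots;\dots,Q_\mu^\dagger,\dots;x\big)+O(s^2).$$ Then for any solution $\Psi$ of the Euler–Lagrange system one has the conservation law $$\sum_{\mu=1}^N\frac{\partial}{\partial x^\mu}\Big\{\mathrm{Tr}\Big[\mathcal L^{(\mu)}_\Psi\big(K\Psi+\textstyle\sum_{\alpha,\beta}A^\alpha_\beta x^\beta\partial_\alpha\Psi\big)+\mathcal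 L^{(\mu\star)}_\Psi\big(K\Psi+\sum_{\alpha,\beta}A^\alpha_\beta x^\beta\partial_\alpha\Psi\big)^\dagger\Big]-\sum_\beta A^\mu_\beta x^\beta\,\mathcal L_\Psi\Big\}=0 .$$
   Context: Fix positive integers $N,r,c$; $^\dagger$ is the conjugate transpose; $(Ax)^\alpha=\sum_\beta A^\alpha_\beta x^\beta$. A proto-Lagrangian is a smooth function $\mathcal L:\mathbb C^{r\times c}\times\mathbb C^{c\times r}\times\mathbb C^{Nr\times c}\times\mathbb C^{c\times Nr}\times\mathbb R^N\to\mathbb C$, holomorphic in the matrix arguments, vanishing when these are all $0$, written $\mathcal L(P;Q^\top;\dots,R_\mu,\dots;\dots,S_\mu^\top,\dots;x)$ with $P,R_\mu\in\mathbb C^{r\times c}$, $Q^\top,S_\mu^\top\in\mathbb C^{c\times r}$, $1\le\mu\le N$. For a function $F$ of a matrix $Z\in\mathbb C^{p\times q}$, $\partial F/\partial Z$ is the $q\times p$ matrix with $(i,j)$ entry $\partial F/\partial Z_{ji}$. The complex partial derivatives of $\mathcal L$ with respect to $P,Q^\top,R_\mu,S_\mu^\top$ are $\mathcal L^{(o)},\mathcal L^{(o\star)},\mathcal L^{(\mu)},\mathcal L^{(\mu\star)}$. For smooth $\Psi:\mathbb R^N\to\mathbb C^{r\times c}$, $\mathcal L_\Psi(x)=\mathcal L(\Psi(x);\Psi^\dagger(x);\dots,\partial_\mu\Psi(x),\dots;\dots,\partial_\mu\Psi^\dagger(x),\dots;x)$, and $\mathcal L^{(o)}_\Psi$ etc.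 are the functions obtained by the same substitution. The Euler–Lagrange system is $$\mathcal L^{(o)}_\Psi-\sum_{\mu}\partial_\mu\mathcal L^{(\mu)}_\Psi=0,\qquad \mathcal L^{(o\star)}_\Psi-\sum_\mu\partial_\mu\mathcal L^{(\mu\star)}_\Psi=0$$ (these two equations are equivalent when the Lagrangian functional $\int\mathcal L_\Psi\,dx$ is real-valued). The constants in $O(s^2)$ (as $s\to0$) may depend on all the independent variables of $\mathcal L$. *)

theory Defs
  imports "HOL-Analysis.Analysis" "HOL-Library.Landau_Symbols"
begin

text \<open>
  The spaces are indexed by finite types: \<open>N = CARD('n)\<close>, \<open>r = CARD('r)\<close>, \<open>c = CARD('c)\<close>.
  An \<open>r \<times> c\<close> matrix has type \<^typ>\<open>complex^'c^'r\<close>. The stacked matrices in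
  \<open>\<complex>\<^bsup>Nr\<times>c\<^esup>\<close> and \<open>\<complex>\<^bsup>c\<times>Nr\<^esup>\<close> are \<open>N\<close>-tuples of blocks, of types
  \<^typ>\<open>(complex^'c^'r)^'n\<close> and \<^typ>\<open>(complex^'r^'c)^'n\<close>.
\<close>

definition dagger :: "complex^'c^'r \<Rightarrow> complex^'r^'c" where
  "dagger Z = (\<chi> i j. cnj (Z $ j $ i))"

definition cscale :: "complex \<Rightarrow> complex^'c^'r \<Rightarrow> complex^'c^'r" where
  "cscale a Z = (\<chi> i j. a * Z $ i $ j)"

lemma vector_space_cscale: "vector_space cscale"
  by unfold_locales (simp_all add: cscale_def vec_eq_iff algebra_simps)

text \<open>The exponential \<open>e\<^sup>T\<close> of a linear operator, as its (pointwise) power series; in finite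
  dimension this converges for every linear \<open>T\<close>.\<close>

definition op_exp :: "('a::real_normed_vector \<Rightarrow> 'a) \<Rightarrow> 'a \<Rightarrow> 'a" where
  "op_exp T v = (\<Sum>k. (T ^^ k) v /\<^sub>R fact k)"

text \<open>\<open>C\<^sup>k\<close> and \<open>C\<^sup>\<infinity>\<close> functions of finitely many real variables: \<open>f\<close> is \<open>C\<^bsup>k+1\<^esup>\<close> iff
  it is differentiable and all of its directional derivatives are \<open>C\<^sup>k\<close>.\<close>

primrec C_k :: "nat \<Rightarrow> ('a::euclidean_space \<Rightarrow> 'b::real_normed_vector) \<Rightarrow> bool" where
  "C_k 0 f \<longleftrightarrow> continuous_on UNIV f"
| "C_k (Suc k) f \<longleftrightarrow> (\<forall>x. f differentiable (at x)) \<and>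
     (\<forall>v. C_k k (\<lambda>x. frechet_derivative f (at x) v))"

definition smooth :: "('a::euclidean_space \<Rightarrow> 'b::real_normed_vector) \<Rightarrow> bool" where
  "smooth f \<longleftrightarrow> (\<forall>k. C_k k f)"

definition partial :: "'n::finite \<Rightarrow> (real^'n \<Rightarrow> 'b::real_normed_vector) \<Rightarrow> real^'n \<Rightarrow> 'b" where
  "partial \<mu> f x = vector_derivative (\<lambda>t. f (x + t *\<^sub>R axis \<mu> 1)) (at 0)"

definition vec_upd :: "'a^'n \<Rightarrow> 'n \<Rightarrow> 'a \<Rightarrow> 'a^'n" where
  "vec_upd v i a = (\<chi> k. if k = i then a else v $ k)"

definition mat_upd :: "'a^'q^'p \<Rightarrow> 'p \<Rightarrow> 'q \<Rightarrow> 'a \<Rightarrow> 'a^'q^'p" where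
  "mat_upd Z i j a = vec_upd Z i (vec_upd (Z $ i) j a)"

text \<open>\<open>\<partial>F/\<partial>Z\<close> has the transposed shape: its \<open>(i,j)\<close> entry is \<open>\<partial>F/\<partial>Z\<^sub>j\<^sub>i\<close>.\<close>

definition mat_deriv :: "(complex^'q^'p \<Rightarrow> complex) \<Rightarrow> complex^'q^'p \<Rightarrow> complex^'p^'q" where
  "mat_deriv F Z = (\<chi> i j. deriv (\<lambda>z. F (mat_upd Z j i z)) (Z $ j $ i))"

definition entrywise_holomorphic :: "(complex^'q^'p \<Rightarrow> complex) \<Rightarrow> bool" where
  "entrywise_holomorphic F \<longleftrightarrow> (\<forall>Z i j. (\<lambda>z. F (mat_upd Z i j z)) holomorphic_on UNIV)"

type_synonym ('n, 'r, 'c, 'b) field_fun =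
  "complex^'c^'r \<Rightarrow> complex^'r^'c \<Rightarrow> (complex^'c^'r)^'n \<Rightarrow> (complex^'r^'c)^'n \<Rightarrow> real^'n \<Rightarrow> 'b"

text \<open>Holomorphy in several variables: a function that is smooth (in particular continuous) in
  all arguments jointly and holomorphic in each complex entry separately.\<close>

definition proto_Lagrangian ::
    "('n::finite, 'r::finite, 'c::finite, complex) field_fun \<Rightarrow> bool" where
  "proto_Lagrangian L \<longleftrightarrow>
     smooth (\<lambda>(P, Q, R, S, x). L P Q R S x) \<and>
     (\<forall>P Q R S x.
        entrywise_holomorphic (\<lambda>Z. L Z Q R S x) \<and>
        entrywise_holomorphic (\<lambda>Z. L P Z R S x) \<and>
        (\<forall>\<mu>. entrywise_holomorphic (\<lambda>Z. L P Q (vec_upd R \<mu> Z) S x)) \<and>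
        (\<forall>\<mu>. entrywise_holomorphic (\<lambda>Z. L P Q R (vec_upd S \<mu> Z) x))) \<and>
     (\<forall>x. L 0 0 0 0 x = 0)"

text \<open>\<open>\<L>\<^bsup>(o)\<^esup>\<close>, \<open>\<L>\<^bsup>(o\<star>)\<^esup>\<close>, \<open>\<L>\<^bsup>(\<mu>)\<^esup>\<close> and \<open>\<L>\<^bsup>(\<mu>\<star>)\<^esup>\<close>, the derivatives in \<open>P\<close>, \<open>Q\<^sup>\<top>\<close>,
  \<open>R\<^sub>\<mu>\<close> and \<open>S\<^sub>\<mu>\<^sup>\<top>\<close>.\<close>

definition L_o ::
    "('n::finite, 'r::finite, 'c::finite, complex) field_fun \<Rightarrow> ('n, 'r, 'c, complex^'r^'c) field_fun" where
  "L_o L P Q R S x = mat_deriv (\<lambda>Z. L Z Q R S x) P"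

definition L_o_star ::
    "('n::finite, 'r::finite, 'c::finite, complex) field_fun \<Rightarrow> ('n, 'r, 'c, complex^'c^'r) field_fun" where
  "L_o_star L P Q R S x = mat_deriv (\<lambda>Z. L P Z R S x) Q"

definition L_d ::
    "('n::finite, 'r::finite, 'c::finite, complex) field_fun
      \<Rightarrow> 'n \<Rightarrow> ('n, 'r, 'c, complex^'r^'c) field_fun" where
  "L_d L \<mu> P Q R S x = mat_deriv (\<lambda>Z. L P Q (vec_upd R \<mu> Z) S x) (R $ \<mu>)"

definition L_d_star ::
    "('n::finite, 'r::finite, 'c::finite, complex) field_fun
      \<Rightarrow> 'n \<Rightarrow> ('n, 'r, 'c, complex^'c^'r) field_fun" where
  "L_d_star L \<mu> P Q R S x = mat_deriv (\<lambda>Z. L P Q R (vec_upd S \<mu> Z) x) (S $ \<mu>)"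

text \<open>The substitution \<open>F \<mapsto> F\<^sub>\<Psi>\<close>.\<close>

definition along ::
    "('n::finite, 'r::finite, 'c::finite, 'b) field_fun
      \<Rightarrow> (real^'n \<Rightarrow> complex^'c^'r) \<Rightarrow> real^'n \<Rightarrow> 'b" where
  "along F \<Psi> x = F (\<Psi> x) (dagger (\<Psi> x))
     (\<chi> \<mu>. partial \<mu> \<Psi> x) (\<chi> \<mu>. partial \<mu> (\<lambda>y. dagger (\<Psi> y)) x) x"

definition Euler_Lagrange ::
    "('n::finite, 'r::finite, 'c::finite, complex) field_fun
      \<Rightarrow> (real^'n \<Rightarrow> complex^'c^'r) \<Rightarrow> bool" where
  "Euler_Lagrange L \<Psi> \<longleftrightarrow> (\<forall>x.
     along (L_o L) \<Psi> x - (\<Sum>\<mu>\<in>UNIV. partial \<mu> (along (L_d L \<mu>) \<Psi>) x) = 0 \<and>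
     along (L_o_star L) \<Psi> x - (\<Sum>\<mu>\<in>UNIV. partial \<mu> (along (L_d_star L \<mu>) \<Psi>) x) = 0)"

text \<open>The map \<open>(tuple_op K A Q)\<^sub>\<mu> = KQ\<^sub>\<mu> + \<Sum>\<^sub>\<nu> A\<^sup>\<nu>\<^sub>\<mu> Q\<^sub>\<nu>\<close>. The entry \<open>A\<^sup>\<alpha>\<^sub>\<beta>\<close> is \<open>A $ \<alpha> $ \<beta>\<close>, in agreement
  with \<open>(Ax)\<^sup>\<alpha> = \<Sum>\<^sub>\<beta> A\<^sup>\<alpha>\<^sub>\<beta> x\<^sup>\<beta>\<close>, so \<open>A\<close> acts transposed here.\<close>

definition tuple_op :: "(complex^'c^'r \<Rightarrow> complex^'c^'r) \<Rightarrow> real^'n^'n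
      \<Rightarrow> (complex^'c^'r)^'n \<Rightarrow> (complex^'c^'r)^'n" where
  "tuple_op K A Q = (\<chi> \<mu>. K (Q $ \<mu>) + (\<Sum>\<nu>\<in>UNIV. A $ \<nu> $ \<mu> *\<^sub>R Q $ \<nu>))"

definition internal_symmetry :: "('n::finite, 'r::finite, 'c::finite, complex) field_fun
      \<Rightarrow> (complex^'c^'r \<Rightarrow> complex^'c^'r) \<Rightarrow> real^'n^'n \<Rightarrow> bool" where
  "internal_symmetry L K A \<longleftrightarrow> (\<forall>P Q x.
     (\<lambda>s::real.
        (let P' = op_exp (\<lambda>Z. s *\<^sub>R K Z) P;
             Q' = op_exp (\<lambda>T. s *\<^sub>R tuple_op K A T) Q
         in L P' (dagger P') Q' (\<chi> \<mu>. dagger (Q' $ \<mu>)) x)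
        - L P (dagger P) Q (\<chi> \<mu>. dagger (Q $ \<mu>)) x)
     \<in> O[at 0](\<lambda>s. complex_of_real (s\<^sup>2)))"

definition external_symmetry :: "('n::finite, 'r::finite, 'c::finite, complex) field_fun
      \<Rightarrow> real^'n^'n \<Rightarrow> bool" where
  "external_symmetry L A \<longleftrightarrow> (\<forall>P Q x.
     (\<lambda>s::real.
        L P (dagger P) Q (\<chi> \<mu>. dagger (Q $ \<mu>)) (op_exp (\<lambda>y. s *\<^sub>R (A *v y)) x)
        - L P (dagger P) Q (\<chi> \<mu>. dagger (Q $ \<mu>)) x)
     \<in> O[at 0](\<lambda>s. complex_of_real (s\<^sup>2)))"

text \<open>The infinitesimal variation \<open>K\<Psi> + \<Sum>\<^sub>\<alpha>\<^sub>,\<^sub>\<beta> A\<^sup>\<alpha>\<^sub>\<beta> x\<^sup>\<beta> \<partial>\<^sub>\<alpha>\<Psi>\<close>.\<close>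

definition variation :: "(complex^'c^'r \<Rightarrow> complex^'c^'r) \<Rightarrow> real^'n^'n
      \<Rightarrow> (real^'n::finite \<Rightarrow> complex^'c^'r) \<Rightarrow> real^'n \<Rightarrow> complex^'c^'r" where
  "variation K A \<Psi> x =
     K (\<Psi> x) + (\<Sum>\<alpha>\<in>UNIV. \<Sum>\<beta>\<in>UNIV. (A $ \<alpha> $ \<beta> * x $ \<beta>) *\<^sub>R partial \<alpha> \<Psi> x)"

end

theory Submission
  imports Defs
begin

text \<open>
  Write \<open>v = K\<Psi> + \<Sum> A\<^sup>\<alpha>\<^sub>\<beta> x\<^sup>\<beta> \<partial>\<^sub>\<alpha>\<Psi>\<close> and \<open>\<xi> = Ax\<close>. By the Euler--Lagrange equations, the divergence of
  \<open>Tr[\<L>\<^sup>\<mu> v] + Tr[\<L>\<^sup>\<mu>\<^sup>\<star> v\<^sup>\<dagger>]\<close> is the total derivative of \<open>\<L>\<close> in the direction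
  \<open>(v, v\<^sup>\<dagger>, (\<partial>\<^sub>\<mu>v), (\<partial>\<^sub>\<mu>v\<^sup>\<dagger>), 0)\<close>. Since second derivatives commute, \<open>\<partial>\<^sub>\<mu>v\<close> is the \<open>\<mu>\<close> component of
  \<open>tuple_op K A (\<partial>\<Psi>)\<close> plus the derivative of \<open>\<partial>\<^sub>\<mu>\<Psi>\<close> along \<open>\<xi>\<close>, so this direction is the generator of the internal
  symmetry plus the derivative of the jet of \<open>\<Psi>\<close> along \<open>\<xi>\<close>, minus the generator \<open>(0, 0, 0, 0, \<xi>)\<close> of the
  external symmetry. Both generators annihilate \<open>\<L>\<close>, so what remains is the derivative of
  \<open>\<L>\<^sub>\<Psi>\<close> along \<open>\<xi>\<close>, which is the divergence of \<open>\<xi> \<L>\<^sub>\<Psi>\<close> because \<open>div \<xi> = Tr A = 0\<close>.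
\<close>

section \<open>Symmetry of mixed second derivatives\<close>

lemma has_derivative_imp_has_vector_derivative:
  assumes "(f has_derivative f') F"
  shows "(f has_vector_derivative f' 1) F"
proof -
  have "(\<lambda>h. h *\<^sub>R f' 1) = f'"
    using linear_scale[OF has_derivative_linear[OF assms], of _ 1, symmetric] by (simp add: fun_eq_iff)
  with assms show ?thesis by (simp add: has_vector_derivative_def)
qed

text \<open>The mean value theorem is used twice: along \<open>u\<close> on the increment of
  \<open>f\<close> in direction \<open>v\<close>, and then along \<open>v\<close> on
  \<open>f' _ u\<close>. The intermediate parameters lie strictly between 0 and \<open>t\<close>, so
  they vanish with \<open>t\<close>.\<close>

lemma mixed_difference_mean_value:
  fixes f :: "'a::real_normed_vector \<Rightarrow> real"
  assumes f: "\<And>y. (f has_derivative f' y) (at y)"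
    and g: "\<And>y. ((\<lambda>y. f' y u) has_derivative g y) (at y)"
    and t: "0 < t"
  obtains a b where "0 < a" "a < t" "0 < b" "b < t"
    "f (x + t *\<^sub>R u + t *\<^sub>R v) - f (x + t *\<^sub>R u) - f (x + t *\<^sub>R v) + f x
      = t\<^sup>2 * g (x + a *\<^sub>R u + b *\<^sub>R v) v"
proof -
  have line: "((\<lambda>a. h (y + a *\<^sub>R w)) has_real_derivative h' (y + a *\<^sub>R w) w) (at a)"
    if "\<And>y. (h has_derivative h' y) (at y)"
    for h :: "'a \<Rightarrow> real" and h' y w a
  proof -
    have "((\<lambda>a. y + a *\<^sub>R w) has_derivative (\<lambda>k. k *\<^sub>R w)) (at a)"
      by (auto intro!: derivative_eq_intros)
    from has_derivative_compose[OF this that]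
    have "((\<lambda>a. h (y + a *\<^sub>R w)) has_derivative (\<lambda>k. h' (y + a *\<^sub>R w) (k *\<^sub>R w))) (at a)" .
    from has_derivative_imp_has_vector_derivative[OF this] show ?thesis
      by (simp add: has_real_derivative_iff_has_vector_derivative)
  qed
  define \<phi> where "\<phi> a = f ((x + t *\<^sub>R v) + a *\<^sub>R u) - f (x + a *\<^sub>R u)" for a
  have "\<exists>a. 0 < a \<and> a < t \<and> \<phi> t - \<phi> 0 =
      (t - 0) * (f' ((x + t *\<^sub>R v) + a *\<^sub>R u) u - f' (x + a *\<^sub>R u) u)"
    unfolding \<phi>_def by (rule MVT2[OF t]) (intro DERIV_diff line f)
  then obtain a where a: "0 < a" "a < t"
    "\<phi> t - \<phi> 0 = t * (f' ((x + t *\<^sub>R v) + a *\<^sub>R u) u - f' (x + a *\<^sub>R u) u)"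
    by auto
  have "\<exists>b. 0 < b \<and> b < t \<and> f' ((x + a *\<^sub>R u) + t *\<^sub>R v) u - f' ((x + a *\<^sub>R u) + 0 *\<^sub>R v) u =
      (t - 0) * g ((x + a *\<^sub>R u) + b *\<^sub>R v) v"
    by (rule MVT2[OF t]) (rule line[where h = "\<lambda>y. f' y u"], rule g)
  then obtain b where "0 < b" "b < t"
    "f' ((x + a *\<^sub>R u) + t *\<^sub>R v) u - f' (x + a *\<^sub>R u) u = t * g ((x + a *\<^sub>R u) + b *\<^sub>R v) v"
    by auto
  with a show thesis
    by (intro that[of a b]) (auto simp: \<phi>_def algebra_simps power2_eq_square)
qed

text \<open>The second difference over the parallelogram with sides \<open>t u\<close> and
  \<open>t v\<close> is unchanged when \<open>u\<close> and \<open>v\<close> are exchanged. Divided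
  by the square of \<open>t\<close>, it is a value of either mixed derivative at a point converging
  to \<open>x\<close>, and continuity at \<open>x\<close> identifies the two limits.\<close>

lemma mixed_derivative_symmetric_real:
  fixes f :: "'a::real_normed_vector \<Rightarrow> real"
  assumes f: "\<And>y. (f has_derivative f' y) (at y)"
    and gu: "\<And>y. ((\<lambda>y. f' y u) has_derivative gu y) (at y)"
    and gv: "\<And>y. ((\<lambda>y. f' y v) has_derivative gv y) (at y)"
    and cu: "isCont (\<lambda>y. gu y v) x" and cv: "isCont (\<lambda>y. gv y u) x"
  shows "gu x v = gv x u"
proof -
  define t where "t n = inverse (real (Suc n))" for n
  have t: "0 < t n" for n by (simp add: t_def)
  have t0: "t \<longlonglongrightarrow> 0"
    unfolding t_def by (rule LIMSEQ_inverse_real_of_nat)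
  have "\<exists>a b. 0 < a \<and> a < t n \<and> 0 < b \<and> b < t n \<and>
      f (x + t n *\<^sub>R u + t n *\<^sub>R v) - f (x + t n *\<^sub>R u) - f (x + t n *\<^sub>R v) + f x
      = (t n)\<^sup>2 * gu (x + a *\<^sub>R u + b *\<^sub>R v) v" for n
    by (rule mixed_difference_mean_value[OF f gu t[of n], where x = x and v = v]) blast
  then obtain a b where ab: "\<And>n. 0 < a n \<and> a n < t n \<and> 0 < b n \<and> b n < t n \<and>
      f (x + t n *\<^sub>R u + t n *\<^sub>R v) - f (x + t n *\<^sub>R u) - f (x + t n *\<^sub>R v) + f x
      = (t n)\<^sup>2 * gu (x + a n *\<^sub>R u + b n *\<^sub>R v) v"
    by metis
  have "\<exists>c d. 0 < c \<and> c < t n \<and> 0 < d \<and> d < t n \<and>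
      f (x + t n *\<^sub>R v + t n *\<^sub>R u) - f (x + t n *\<^sub>R v) - f (x + t n *\<^sub>R u) + f x
      = (t n)\<^sup>2 * gv (x + c *\<^sub>R v + d *\<^sub>R u) u" for n
    by (rule mixed_difference_mean_value[OF f gv t[of n], where x = x and v = u]) blast
  then obtain c d where cd: "\<And>n. 0 < c n \<and> c n < t n \<and> 0 < d n \<and> d n < t n \<and>
      f (x + t n *\<^sub>R v + t n *\<^sub>R u) - f (x + t n *\<^sub>R v) - f (x + t n *\<^sub>R u) + f x
      = (t n)\<^sup>2 * gv (x + c n *\<^sub>R v + d n *\<^sub>R u) u"
    by metis
  have eq: "gu (x + a n *\<^sub>R u + b n *\<^sub>R v) v = gv (x + c n *\<^sub>R v + d n *\<^sub>R u) u" for n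
  proof -
    have "(t n)\<^sup>2 * gu (x + a n *\<^sub>R u + b n *\<^sub>R v) v = (t n)\<^sup>2 * gv (x + c n *\<^sub>R v + d n *\<^sub>R u) u"
      using ab[of n] cd[of n] by (simp add: algebra_simps)
    then show ?thesis using t[of n] by simp
  qed
  have squeeze: "e \<longlonglongrightarrow> 0" if "\<And>n. 0 < e n \<and> e n < t n" for e
    by (rule tendsto_sandwich[OF _ _ tendsto_const t0])
      (use that in \<open>auto intro!: always_eventually less_imp_le\<close>)
  have "a \<longlonglongrightarrow> 0" "b \<longlonglongrightarrow> 0" "c \<longlonglongrightarrow> 0" "d \<longlonglongrightarrow> 0"
    using ab cd by (auto intro!: squeeze)
  then have "(\<lambda>n. x + a n *\<^sub>R u + b n *\<^sub>R v) \<longlonglongrightarrow> x + 0 *\<^sub>R u + 0 *\<^sub>R v"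
    and "(\<lambda>n. x + c n *\<^sub>R v + d n *\<^sub>R u) \<longlonglongrightarrow> x + 0 *\<^sub>R v + 0 *\<^sub>R u"
    by - (intro tendsto_intros; assumption)+
  then have lim: "(\<lambda>n. x + a n *\<^sub>R u + b n *\<^sub>R v) \<longlonglongrightarrow> x"
    "(\<lambda>n. x + c n *\<^sub>R v + d n *\<^sub>R u) \<longlonglongrightarrow> x"
    by simp_all
  show ?thesis
    using isCont_tendsto_compose[OF cu lim(1)] isCont_tendsto_compose[OF cv lim(2)]
    unfolding eq by (rule LIMSEQ_unique)
qed

text \<open>The mean value argument needs real values, so it is applied to each component
  \<open>f y \<bullet> b\<close>.\<close>

lemma mixed_derivative_symmetric:
  fixes f :: "'a::real_normed_vector \<Rightarrow> 'b::euclidean_space"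
  assumes f: "\<And>y. (f has_derivative f' y) (at y)"
    and gu: "\<And>y. ((\<lambda>y. f' y u) has_derivative gu y) (at y)"
    and gv: "\<And>y. ((\<lambda>y. f' y v) has_derivative gv y) (at y)"
    and cu: "isCont (\<lambda>y. gu y v) x" and cv: "isCont (\<lambda>y. gv y u) x"
  shows "gu x v = gv x u"
proof (rule euclidean_eqI)
  fix b :: 'b
  show "gu x v \<bullet> b = gv x u \<bullet> b"
    by (rule mixed_derivative_symmetric_real[where f = "\<lambda>y. f y \<bullet> b" and f' = "\<lambda>y k. f' y k \<bullet> b"
          and gu = "\<lambda>y k. gu y k \<bullet> b" and gv = "\<lambda>y k. gv y k \<bullet> b"])
      (use f gu gv cu cv in \<open>auto intro: has_derivative_inner_left continuous_inner\<close>)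
qed

lemma smooth_has_derivative:
  assumes "smooth f"
  shows "(f has_derivative frechet_derivative f (at x)) (at x)"
proof -
  have "C_k (Suc 0) f" using assms by (simp only: smooth_def)
  then show ?thesis by (simp add: frechet_derivative_works)
qed

lemma smooth_frechet_derivative:
  assumes "smooth f"
  shows "smooth (\<lambda>x. frechet_derivative f (at x) v)"
  unfolding smooth_def
proof
  fix k
  have "C_k (Suc k) f" using assms by (simp only: smooth_def)
  then show "C_k k (\<lambda>x. frechet_derivative f (at x) v)" by simp
qed

lemma smooth_isCont:
  assumes "smooth f"
  shows "isCont f x"
  using has_derivative_continuous[OF smooth_has_derivative[OF assms]] .

lemma smooth_frechet_derivative_symmetric:
  fixes f :: "'a::euclidean_space \<Rightarrow> 'b::euclidean_space"
  assumes "smooth f"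
  shows "frechet_derivative (\<lambda>y. frechet_derivative f (at y) u) (at x) v
       = frechet_derivative (\<lambda>y. frechet_derivative f (at y) v) (at x) u"
proof -
  have sm: "smooth (\<lambda>y. frechet_derivative f (at y) w)" for w
    using assms by (rule smooth_frechet_derivative)
  show ?thesis
    by (rule mixed_derivative_symmetric[OF smooth_has_derivative[OF assms]
          smooth_has_derivative[OF sm] smooth_has_derivative[OF sm]
          smooth_isCont[OF smooth_frechet_derivative[OF sm]]
          smooth_isCont[OF smooth_frechet_derivative[OF sm]]])
qed

section \<open>Partial derivatives and calculus of vectors and matrices\<close>

lemma partial_eq:
  assumes "(f has_derivative f') (at x)"
  shows "partial \<mu> f x = f' (axis \<mu> 1)"
proof -
  have "((\<lambda>t. x + t *\<^sub>R axis \<mu> 1) has_derivative (\<lambda>k. k *\<^sub>R axis \<mu> 1)) (at 0)"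
    by (auto intro!: derivative_eq_intros)
  from has_derivative_compose[OF this, of f f'] assms
  have "((\<lambda>t. f (x + t *\<^sub>R axis \<mu> 1)) has_derivative (\<lambda>k. f' (k *\<^sub>R axis \<mu> 1))) (at 0)"
    by simp
  from has_derivative_imp_has_vector_derivative[OF this] show ?thesis
    unfolding partial_def by (intro vector_derivative_at) simp
qed

lemma vec_eq_sum_axis: "(v :: 'b::comm_monoid_add ^ 'i::finite) = (\<Sum>i\<in>UNIV. axis i (v $ i))"
  by (simp add: vec_eq_iff axis_def sum.delta)

lemma vec_lambda_axis_sum:
  fixes f :: "'i::finite \<Rightarrow> 'b::comm_monoid_add"
  shows "(\<Sum>i\<in>UNIV. axis i (f i)) = (\<chi> i. f i)"
  by (subst vec_eq_sum_axis[of "vec_lambda f"]) simp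

lemma linear_eq_sum_axis:
  fixes f :: "real^'n::finite \<Rightarrow> 'b::real_vector"
  assumes "linear f"
  shows "f y = (\<Sum>\<mu>\<in>UNIV. y $ \<mu> *\<^sub>R f (axis \<mu> 1))"
proof -
  have "y = (\<Sum>\<mu>\<in>UNIV. y $ \<mu> *\<^sub>R axis \<mu> 1)"
    by (simp add: vec_eq_iff axis_def if_distrib cong: if_cong)
  from arg_cong[OF this, of f] show ?thesis
    by (simp only: linear_sum[OF assms] linear_scale[OF assms])
qed

lemma bounded_linear_axis: "bounded_linear (axis i :: 'b::euclidean_space \<Rightarrow> 'b ^ 'i::finite)"
  unfolding linear_conv_bounded_linear[symmetric]
  by (rule linearI) (simp_all add: vec_eq_iff axis_def)

text \<open>Writing the vector as the sum of the \<open>axis i (f x i)\<close> reduces the claim to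
  finite sums and bounded linear maps.\<close>

lemma has_derivative_vec_lambda:
  fixes f :: "'a::real_normed_vector \<Rightarrow> 'i::finite \<Rightarrow> 'b::euclidean_space"
  assumes "\<And>i. ((\<lambda>x. f x i) has_derivative f' i) F"
  shows "((\<lambda>x. \<chi> i. f x i) has_derivative (\<lambda>h. \<chi> i. f' i h)) F"
proof -
  have "((\<lambda>x. \<Sum>i\<in>UNIV. axis i (f x i)) has_derivative (\<lambda>h. \<Sum>i\<in>UNIV. axis i (f' i h))) F"
    by (intro has_derivative_sum bounded_linear.has_derivative[OF bounded_linear_axis] assms)
  then show ?thesis by (simp add: vec_lambda_axis_sum)
qed

lemma bounded_linear_dagger: "bounded_linear (dagger :: complex^'c^'r \<Rightarrow> complex^'r^'c)"
  unfolding linear_conv_bounded_linear[symmetric]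
  by (rule linearI) (simp_all add: vec_eq_iff dagger_def)

text \<open>Supplies the product rule for the trace terms of the current and lets sums of matrices
  pass out of the trace.\<close>

lemma bounded_bilinear_trace_mult:
  "bounded_bilinear (\<lambda>(M :: complex^'r^'c) (Z :: complex^'c^'r). trace (M ** Z))"
proof -
  have "bilinear (\<lambda>(M :: complex^'r^'c) (Z :: complex^'c^'r). trace (M ** Z))"
    unfolding bilinear_def
    by (auto intro!: linearI simp: trace_def matrix_matrix_mult_def sum.distrib scaleR_sum_right
        algebra_simps)
  then show ?thesis by (simp add: bilinear_conv_bounded_bilinear)
qed

section \<open>The operator exponential and its first-order term\<close>

lemma power_scaleR_linear:
  fixes T :: "'a::real_vector \<Rightarrow> 'a"
  assumes "linear T"
  shows "((\<lambda>v. s *\<^sub>R T v) ^^ k) v = s ^ k *\<^sub>R (T ^^ k) v"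
  by (induction k) (simp_all add: linear_scale[OF assms] mult.commute)

lemma op_exp_0: "op_exp (\<lambda>v. 0) w = w"
proof -
  have "((\<lambda>v. 0) ^^ k) w /\<^sub>R fact k = (if k = 0 then w else 0)" for k
    by (cases k) auto
  then show ?thesis
    unfolding op_exp_def using sums_unique[OF sums_single[of 0 "\<lambda>_. w"]] by simp
qed

text \<open>An operator bound \<open>B\<close> dominates the series by \<open>norm v\<close> times
  the exponential series of \<open>B\<close>.\<close>

lemma summable_op_exp:
  fixes T :: "'a::euclidean_space \<Rightarrow> 'a"
  assumes "linear T"
  shows "summable (\<lambda>k. (T ^^ k) v /\<^sub>R fact k)"
proof -
  obtain B where B: "0 < B" "\<And>x. norm (T x) \<le> B * norm x"
    using linear_bounded_pos[OF assms] by auto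
  have "norm ((T ^^ k) v) \<le> B ^ k * norm v" for k
  proof (induction k)
    case (Suc k)
    have "norm ((T ^^ Suc k) v) \<le> B * norm ((T ^^ k) v)" using B(2) by simp
    also have "\<dots> \<le> B * (B ^ k * norm v)" using Suc B(1) by simp
    finally show ?case by (simp add: mult.assoc)
  qed simp
  then have "norm ((T ^^ k) v /\<^sub>R fact k) \<le> B ^ k /\<^sub>R fact k * norm v" for k
    by (simp add: divide_simps)
  moreover have "summable (\<lambda>k. B ^ k /\<^sub>R fact k * norm v)"
    by (intro summable_mult2 summable_exp_generic)
  ultimately show ?thesis by (rule summable_comparison_test'[rotated])
qed

text \<open>Paired with a fixed vector \<open>b\<close>, the exponential is an everywhere convergent
  power series in \<open>s\<close>, which may be differentiated termwise.\<close>

lemma op_exp_has_vector_derivative: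
  fixes T :: "'a::euclidean_space \<Rightarrow> 'a"
  assumes T: "linear T"
  shows "((\<lambda>s. op_exp (\<lambda>v. s *\<^sub>R T v) w) has_vector_derivative T w) (at 0)"
proof -
  have "((\<lambda>s. op_exp (\<lambda>v. s *\<^sub>R T v) w \<bullet> b) has_derivative (\<lambda>h. (h *\<^sub>R T w) \<bullet> b)) (at 0)" for b
  proof -
    define c where "c k = ((T ^^ k) w \<bullet> b) / fact k" for k
    have lin: "linear (\<lambda>v. s *\<^sub>R T v)" for s
      using T by (rule linear_compose_scale_right)
    have eq: "(((\<lambda>v. s *\<^sub>R T v) ^^ k) w /\<^sub>R fact k) \<bullet> b = c k * s ^ k" for s k
      by (simp add: power_scaleR_linear[OF T] c_def divide_inverse)
    have sums: "(\<lambda>k. c k * s ^ k) sums (op_exp (\<lambda>v. s *\<^sub>R T v) w \<bullet> b)" for s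
      using bounded_linear.sums[OF bounded_linear_inner_left
          summable_sums[OF summable_op_exp[OF lin, of s w]], of b]
      by (simp only: eq op_exp_def)
    have "((\<lambda>s. \<Sum>k. c k * s ^ k) has_real_derivative (\<Sum>k. diffs c k * 0 ^ k)) (at 0)"
      by (rule termdiffs_strong_converges_everywhere) (rule sums_summable[OF sums])
    \<comment> \<open>At the origin only the constant term survives, and \<open>diffs\<close> shifts
      the index by one, so the value is \<open>c 1\<close>.\<close>
    moreover have "(\<Sum>k. diffs c k * 0 ^ k) = T w \<bullet> b"
      by (subst powser_zero) (simp add: diffs_def c_def)
    moreover have "(*) (T w \<bullet> b) = (\<lambda>h. (h *\<^sub>R T w) \<bullet> b)" by auto
    ultimately show ?thesis
      by (simp only: sums_unique[OF sums, symmetric] has_field_derivative_def)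
  qed
  then show ?thesis
    unfolding has_vector_derivative_def by (subst has_derivative_componentwise_within) auto
qed

text \<open>The difference quotient is bounded by \<open>C * \<bar>s\<bar>\<close> near 0, so 0 is a
  derivative too, and derivatives are unique. This turns a symmetry up to second order into an exact
  infinitesimal identity.\<close>

lemma has_vector_derivative_bigo_square:
  fixes g :: "real \<Rightarrow> complex"
  assumes g: "(g has_vector_derivative d) (at 0)"
    and O: "(\<lambda>s. g s - g 0) \<in> O[at 0](\<lambda>s. complex_of_real (s\<^sup>2))"
  shows "d = 0"
proof -
  obtain C where C: "0 < C" "eventually (\<lambda>s. norm (g s - g 0) \<le> C * norm (complex_of_real (s\<^sup>2))) (at 0)"
    using landau_o.bigE[OF O] by blast
  have "((\<lambda>s. norm (g s - g 0) / norm s) \<longlongrightarrow> 0) (at 0)"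
  proof (rule Lim_null_comparison)
    show "eventually (\<lambda>s. norm (norm (g s - g 0) / norm s) \<le> C * \<bar>s\<bar>) (at 0)"
      using C(2) eventually_neq_at_within[of 0]
      by eventually_elim (simp add: divide_simps norm_mult power2_eq_square mult.assoc)
    show "((\<lambda>s::real. C * \<bar>s\<bar>) \<longlongrightarrow> 0) (at 0)"
      by (auto intro!: tendsto_eq_intros)
  qed
  then have "(g has_vector_derivative 0) (at 0)"
    by (simp add: has_vector_derivative_def has_derivative_iff_norm)
  with g show ?thesis
    by (rule vector_derivative_unique_at)
qed

section \<open>Matrix derivatives as trace pairings\<close>

text \<open>Holomorphy makes the real derivative in each entry a multiplication by the complex
  derivative. Summing over the entries gives \<open>G' H\<close>, and the transposed shape of
  \<open>mat_deriv\<close> makes this sum a trace.\<close>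

lemma trace_mat_deriv:
  fixes G :: "complex^'q^'p \<Rightarrow> complex"
  assumes G: "(G has_derivative G') (at Z)" and hol: "entrywise_holomorphic G"
  shows "trace (mat_deriv G Z ** H) = G' H"
proof -
  have entry: "mat_deriv G Z $ i $ j * h = G' (axis j (axis i h))" for i j h
  proof -
    \<comment> \<open>Replacing one entry is a translation along a matrix unit, hence affine in
      \<open>z\<close>.\<close>
    have upd: "mat_upd Z j i z = Z + axis j (axis i (z - Z $ j $ i))" for z
      by (simp add: mat_upd_def vec_upd_def axis_def vec_eq_iff)
    have "((\<lambda>z. Z + axis j (axis i (z - Z $ j $ i))) has_derivative (\<lambda>h. axis j (axis i h))) (at (Z $ j $ i))"
      by (auto intro!: derivative_eq_intros bounded_linear.has_derivative[OF bounded_linear_axis])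
    then have "((\<lambda>z. mat_upd Z j i z) has_derivative (\<lambda>h. axis j (axis i h))) (at (Z $ j $ i))"
      by (simp add: upd)
    moreover have "mat_upd Z j i (Z $ j $ i) = Z"
      by (simp add: upd axis_def vec_eq_iff)
    ultimately have "((\<lambda>z. G (mat_upd Z j i z)) has_derivative (\<lambda>h. G' (axis j (axis i h)))) (at (Z $ j $ i))"
      using has_derivative_compose[of "mat_upd Z j i" _ "Z $ j $ i" UNIV G G'] G by simp
    moreover have "(\<lambda>z. G (mat_upd Z j i z)) holomorphic_on UNIV"
      using hol by (simp add: entrywise_holomorphic_def)
    then have "((\<lambda>z. G (mat_upd Z j i z)) has_derivative (*) (mat_deriv G Z $ i $ j)) (at (Z $ j $ i))"
      using holomorphic_derivI[of _ UNIV] by (simp add: mat_deriv_def has_field_derivative_def)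
    \<comment> \<open>The chain rule and holomorphy give two real derivatives of the same function
      of one entry, so they agree.\<close>
    ultimately have "(*) (mat_deriv G Z $ i $ j) = (\<lambda>h. G' (axis j (axis i h)))"
      by (intro has_derivative_unique)
    then show ?thesis by (rule fun_cong)
  qed
  have lin: "linear G'" using G by (rule has_derivative_linear)
  have "H = (\<Sum>j\<in>UNIV. axis j (\<Sum>i\<in>UNIV. axis i (H $ j $ i)))"
    by (simp flip: vec_eq_sum_axis)
  then have "G' H = G' (\<Sum>j\<in>UNIV. axis j (\<Sum>i\<in>UNIV. axis i (H $ j $ i)))"
    by (rule arg_cong)
  also have "\<dots> = (\<Sum>j\<in>UNIV. \<Sum>i\<in>UNIV. mat_deriv G Z $ i $ j * H $ j $ i)"
    by (simp add: linear_sum[OF lin] linear_sum[OF bounded_linear.linear[OF bounded_linear_axis]] entry)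
  also have "\<dots> = trace (mat_deriv G Z ** H)"
    by (subst sum.swap) (simp add: trace_def matrix_matrix_mult_def)
  finally show ?thesis ..
qed

text \<open>The exponentials and total derivatives are taken over the reals, and a real scalar acts
  as the corresponding complex one.\<close>

lemma linear_cscale_imp_linear:
  assumes "Vector_Spaces.linear cscale cscale K"
  shows "linear K"
proof -
  interpret K: Vector_Spaces.linear cscale cscale K by fact
  have scaleR: "a *\<^sub>R Z = cscale (complex_of_real a) Z" for a and Z :: "complex^'q^'p"
    by (simp add: cscale_def vec_eq_iff scaleR_conv_of_real[where 'a = complex])
  show ?thesis
    by (rule linearI) (simp_all only: scaleR K.add K.scale)
qed

section \<open>The total derivative of the Lagrangian\<close>

text \<open>The five slots are differentiated jointly and over the reals, because \<open>x\<close>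
  is real and the dagger is conjugate-linear.\<close>

definition total_deriv ::
    "('n::finite, 'r::finite, 'c::finite, complex) field_fun
      \<Rightarrow> (complex^'c^'r) \<times> (complex^'r^'c) \<times> ((complex^'c^'r)^'n) \<times> ((complex^'r^'c)^'n) \<times> (real^'n)
      \<Rightarrow> (complex^'c^'r) \<times> (complex^'r^'c) \<times> ((complex^'c^'r)^'n) \<times> ((complex^'r^'c)^'n) \<times> (real^'n)
      \<Rightarrow> complex" where
  "total_deriv L z = frechet_derivative (\<lambda>(P, Q, R, S, x). L P Q R S x) (at z)"

text \<open>The dagger stands outside the partial derivative, unlike in \<open>along\<close>;
  \<open>partial_dagger\<close> reconciles the two for smooth fields. The base point
  \<open>x\<close> is kept as a last component, so that differentiating the jet also sees the
  explicit dependence on \<open>x\<close>.\<close>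

definition jet :: "(real^'n::finite \<Rightarrow> complex^'c^'r) \<Rightarrow> real^'n
      \<Rightarrow> (complex^'c^'r) \<times> (complex^'r^'c) \<times> ((complex^'c^'r)^'n) \<times> ((complex^'r^'c)^'n) \<times> (real^'n)" where
  "jet \<Psi> x = (\<Psi> x, dagger (\<Psi> x), \<chi> \<mu>. partial \<mu> \<Psi> x, \<chi> \<mu>. dagger (partial \<mu> \<Psi> x), x)"

context
  fixes L :: "('n::finite, 'r::finite, 'c::finite, complex) field_fun"
  assumes L: "proto_Lagrangian L"
begin

lemma proto_Lagrangian_has_derivative:
  "((\<lambda>(P, Q, R, S, x). L P Q R S x) has_derivative total_deriv L z) (at z)"
  unfolding total_deriv_def by (rule smooth_has_derivative) (use L in \<open>simp add: proto_Lagrangian_def\<close>)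

lemma linear_total_deriv: "linear (total_deriv L z)"
  using proto_Lagrangian_has_derivative by (rule has_derivative_linear)

text \<open>The chain rule in curried form: constant slots yield the derivatives in a single
  argument, and curves yield the symmetry generators.\<close>

lemma proto_Lagrangian_compose_has_derivative:
  assumes "(p has_derivative p') (at t)" "(q has_derivative q') (at t)"
    "(r has_derivative r') (at t)" "(s has_derivative s') (at t)" "(y has_derivative y') (at t)"
  shows "((\<lambda>t. L (p t) (q t) (r t) (s t) (y t)) has_derivative
    (\<lambda>h. total_deriv L (p t, q t, r t, s t, y t) (p' h, q' h, r' h, s' h, y' h))) (at t)"
proof -
  have "((\<lambda>t. (p t, q t, r t, s t, y t)) has_derivative (\<lambda>h. (p' h, q' h, r' h, s' h, y' h))) (at t)"
    by (intro has_derivative_Pair assms)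
  from has_derivative_compose[OF this proto_Lagrangian_has_derivative] show ?thesis by simp
qed

text \<open>Freezing the other four slots leaves a function holomorphic in each entry of one matrix,
  to which \<open>trace_mat_deriv\<close> applies; the analogous identities for the other slots rest
  on the same argument.\<close>

lemma trace_L_o: "trace (L_o L P Q R S x ** H) = total_deriv L (P, Q, R, S, x) (H, 0, 0, 0, 0)"
  unfolding L_o_def
  by (rule trace_mat_deriv, rule proto_Lagrangian_compose_has_derivative[OF has_derivative_ident
      has_derivative_const has_derivative_const has_derivative_const has_derivative_const])
    (use L in \<open>simp add: proto_Lagrangian_def\<close>)

lemma trace_L_o_star:
  "trace (L_o_star L P Q R S x ** H) = total_deriv L (P, Q, R, S, x) (0, H, 0, 0, 0)"
  unfolding L_o_star_def
  by (rule trace_mat_deriv, rule proto_Lagrangian_compose_has_derivative[OF has_derivative_const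
      has_derivative_ident has_derivative_const has_derivative_const has_derivative_const])
    (use L in \<open>simp add: proto_Lagrangian_def\<close>)

lemma vec_upd_has_derivative:
  fixes v :: "'b::euclidean_space ^ 'i::finite"
  shows "(vec_upd v \<mu> has_derivative axis \<mu>) (at Z)"
proof -
  have "vec_upd v \<mu> = (\<lambda>Z. v + axis \<mu> (Z - v $ \<mu>))"
    by (simp add: fun_eq_iff vec_upd_def axis_def vec_eq_iff)
  moreover have "((\<lambda>Z. v + axis \<mu> (Z - v $ \<mu>)) has_derivative axis \<mu>) (at Z)"
    by (auto intro!: derivative_eq_intros bounded_linear.has_derivative[OF bounded_linear_axis])
  ultimately show ?thesis by simp
qed

lemma vec_upd_self [simp]: "vec_upd v \<mu> (v $ \<mu>) = v"
  by (simp add: vec_upd_def vec_eq_iff)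

lemma trace_L_d:
  "trace (L_d L \<mu> P Q R S x ** H) = total_deriv L (P, Q, R, S, x) (0, 0, axis \<mu> H, 0, 0)"
  unfolding L_d_def
proof (rule trace_mat_deriv)
  show "((\<lambda>Z. L P Q (vec_upd R \<mu> Z) S x) has_derivative
      (\<lambda>H. total_deriv L (P, Q, R, S, x) (0, 0, axis \<mu> H, 0, 0))) (at (R $ \<mu>))"
    using proto_Lagrangian_compose_has_derivative[OF has_derivative_const has_derivative_const
        vec_upd_has_derivative[of R \<mu> "R $ \<mu>"] has_derivative_const has_derivative_const]
    by simp
qed (use L in \<open>simp add: proto_Lagrangian_def\<close>)

lemma trace_L_d_star:
  "trace (L_d_star L \<mu> P Q R S x ** H) = total_deriv L (P, Q, R, S, x) (0, 0, 0, axis \<mu> H, 0)"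
  unfolding L_d_star_def
proof (rule trace_mat_deriv)
  show "((\<lambda>Z. L P Q R (vec_upd S \<mu> Z) x) has_derivative
      (\<lambda>H. total_deriv L (P, Q, R, S, x) (0, 0, 0, axis \<mu> H, 0))) (at (S $ \<mu>))"
    using proto_Lagrangian_compose_has_derivative[OF has_derivative_const has_derivative_const
        has_derivative_const vec_upd_has_derivative[of S \<mu> "S $ \<mu>"] has_derivative_const]
    by simp
qed (use L in \<open>simp add: proto_Lagrangian_def\<close>)

section \<open>Infinitesimal form of the symmetries\<close>

text \<open>The direction is the velocity at \<open>s = 0\<close> of the curve moved by the
  exponentials of \<open>K\<close> and \<open>tuple_op K A\<close>. By the chain rule the left side
  is the derivative of \<open>L\<close> along this curve, which the second-order bound forces to be
  0.\<close>

lemma internal_symmetry_infinitesimal: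
  assumes K: "linear K" and sym: "internal_symmetry L K A"
  shows "total_deriv L (P, dagger P, Q, \<chi> \<mu>. dagger (Q $ \<mu>), x)
    (K P, dagger (K P), tuple_op K A Q, \<chi> \<mu>. dagger (tuple_op K A Q $ \<mu>), 0) = 0"
proof -
  define p where "p s = op_exp (\<lambda>Z. s *\<^sub>R K Z) P" for s
  define q where "q s = op_exp (\<lambda>T. s *\<^sub>R tuple_op K A T) Q" for s
  have T: "linear (tuple_op K A)"
    by (rule linearI)
      (simp_all add: tuple_op_def vec_eq_iff linear_add[OF K] linear_scale[OF K] sum.distrib
        scaleR_sum_right scaleR_add_right mult.commute algebra_simps)
  have p0: "p 0 = P" and q0: "q 0 = Q" by (simp_all add: p_def q_def op_exp_0)
  have p: "(p has_derivative (\<lambda>h. h *\<^sub>R K P)) (at 0)"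
    and q: "(q has_derivative (\<lambda>h. h *\<^sub>R tuple_op K A Q)) (at 0)"
    unfolding p_def q_def has_vector_derivative_def[symmetric]
    by (rule op_exp_has_vector_derivative, fact)+
  have "((\<lambda>s. L (p s) (dagger (p s)) (q s) (\<chi> \<mu>. dagger (q s $ \<mu>)) x) has_derivative
    (\<lambda>h. total_deriv L (p 0, dagger (p 0), q 0, \<chi> \<mu>. dagger (q 0 $ \<mu>), x)
      (h *\<^sub>R K P, dagger (h *\<^sub>R K P), h *\<^sub>R tuple_op K A Q,
       \<chi> \<mu>. dagger ((h *\<^sub>R tuple_op K A Q) $ \<mu>), 0))) (at 0)"
    by (intro proto_Lagrangian_compose_has_derivative p q has_derivative_const
        has_derivative_vec_lambda bounded_linear.has_derivative[OF bounded_linear_dagger]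
        bounded_linear.has_derivative[OF bounded_linear_vec_nth])
  from has_derivative_imp_has_vector_derivative[OF this]
  show ?thesis
  proof (simp only: p0 q0 scaleR_one, elim has_vector_derivative_bigo_square)
    show "(\<lambda>s. L (p s) (dagger (p s)) (q s) (\<chi> \<mu>. dagger (q s $ \<mu>)) x
        - L (p 0) (dagger (p 0)) (q 0) (\<chi> \<mu>. dagger (q 0 $ \<mu>)) x)
      \<in> O[at 0](\<lambda>s. complex_of_real (s\<^sup>2))"
      using sym unfolding internal_symmetry_def p0 q0 by (simp only: p_def q_def Let_def)
  qed
qed

text \<open>The same argument, with only the base point moving, at velocity
  \<open>A *v x\<close>.\<close>

lemma external_symmetry_infinitesimal:
  assumes sym: "external_symmetry L A"
  shows "total_deriv L (P, dagger P, Q, \<chi> \<mu>. dagger (Q $ \<mu>), x) (0, 0, 0, 0, A *v x) = 0"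
proof -
  define y where "y s = op_exp (\<lambda>y. s *\<^sub>R (A *v y)) x" for s
  have y0: "y 0 = x" by (simp add: y_def op_exp_0)
  have y: "(y has_derivative (\<lambda>h. h *\<^sub>R (A *v x))) (at 0)"
    unfolding y_def has_vector_derivative_def[symmetric]
    by (rule op_exp_has_vector_derivative) simp
  have "((\<lambda>s. L P (dagger P) Q (\<chi> \<mu>. dagger (Q $ \<mu>)) (y s)) has_derivative
    (\<lambda>h. total_deriv L (P, dagger P, Q, \<chi> \<mu>. dagger (Q $ \<mu>), y 0) (0, 0, 0, 0, h *\<^sub>R (A *v x)))) (at 0)"
    by (intro proto_Lagrangian_compose_has_derivative y has_derivative_const)
  from has_derivative_imp_has_vector_derivative[OF this]
  show ?thesis
  proof (simp only: y0 scaleR_one, elim has_vector_derivative_bigo_square)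
    show "(\<lambda>s. L P (dagger P) Q (\<chi> \<mu>. dagger (Q $ \<mu>)) (y s)
        - L P (dagger P) Q (\<chi> \<mu>. dagger (Q $ \<mu>)) (y 0)) \<in> O[at 0](\<lambda>s. complex_of_real (s\<^sup>2))"
      using sym unfolding external_symmetry_def y0 by (simp only: y_def)
  qed
qed

text \<open>Smoothness of \<open>L\<close> supplies the second derivatives needed to differentiate
  its matrix derivatives along a field.\<close>

lemma total_deriv_differentiable: "(\<lambda>z. total_deriv L z v) differentiable (at z)"
  unfolding total_deriv_def differentiable_def
  by (rule exI, rule smooth_has_derivative, rule smooth_frechet_derivative)
    (use L in \<open>simp add: proto_Lagrangian_def\<close>)

end

section \<open>Derivatives of the Lagrangian along the jet of a field\<close>

lemma smooth_partial:
  assumes "smooth \<Psi>"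
  shows "smooth (partial \<mu> \<Psi>)"
proof -
  have "partial \<mu> \<Psi> = (\<lambda>x. frechet_derivative \<Psi> (at x) (axis \<mu> 1))"
    using partial_eq[OF smooth_has_derivative[OF assms]] by (simp add: fun_eq_iff)
  with smooth_frechet_derivative[OF assms] show ?thesis by simp
qed

lemma partial_dagger:
  assumes "smooth \<Psi>"
  shows "partial \<mu> (\<lambda>y. dagger (\<Psi> y)) x = dagger (partial \<mu> \<Psi> x)"
  using partial_eq[OF bounded_linear.has_derivative[OF bounded_linear_dagger smooth_has_derivative[OF assms]]]
    partial_eq[OF smooth_has_derivative[OF assms]] by simp

lemma along_eq_jet:
  assumes "smooth \<Psi>"
  shows "along F \<Psi> x = (case jet \<Psi> x of (P, Q, R, S, y) \<Rightarrow> F P Q R S y)"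
  by (simp add: along_def jet_def partial_dagger[OF assms])

lemma jet_has_derivative:
  assumes "smooth \<Psi>"
  shows "(jet \<Psi> has_derivative (\<lambda>h. (frechet_derivative \<Psi> (at x) h, dagger (frechet_derivative \<Psi> (at x) h),
     \<chi> \<mu>. frechet_derivative (partial \<mu> \<Psi>) (at x) h,
     \<chi> \<mu>. dagger (frechet_derivative (partial \<mu> \<Psi>) (at x) h), h))) (at x)"
  unfolding jet_def
  by (intro has_derivative_Pair has_derivative_vec_lambda has_derivative_ident
      bounded_linear.has_derivative[OF bounded_linear_dagger] smooth_has_derivative smooth_partial assms)

text \<open>The entries of a matrix-valued \<open>G\<close> are the pairings \<open>trace (G x ** E)\<close> with matrix units.\<close>

lemma differentiable_if_traces:
  fixes G :: "'a::real_normed_vector \<Rightarrow> complex^'p^'q"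
  assumes "\<And>H. (\<lambda>x. trace (G x ** H)) differentiable (at x)"
  shows "G differentiable (at x)"
proof -
  have entry: "trace (M ** axis j (axis i 1)) = M $ i $ j" for M :: "complex^'p^'q" and i j
  proof -
    have "axis j (axis i 1) $ b $ a = (if b = j then if a = i then 1 else 0 else 0 :: complex)" for a b
      by (simp add: axis_def)
    then have "M $ a $ b * axis j (axis i 1) $ b $ a = (if b = j then if a = i then M $ a $ b else 0 else 0)" for a b
      by simp
    then show ?thesis by (simp add: trace_def matrix_matrix_mult_def)
  qed
  have "\<exists>D. ((\<lambda>x. G x $ i $ j) has_derivative D) (at x)" for i j
    using assms[of "axis j (axis i 1)"] unfolding entry differentiable_def .
  then obtain D where D: "\<And>i j. ((\<lambda>x. G x $ i $ j) has_derivative D i j) (at x)" by metis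
  have "((\<lambda>x. \<chi> i j. G x $ i $ j) has_derivative (\<lambda>h. \<chi> i j. D i j h)) (at x)"
    by (intro has_derivative_vec_lambda D)
  then show ?thesis by (auto simp: differentiable_def)
qed

lemma trace_along:
  assumes L: "proto_Lagrangian L" and \<Psi>: "smooth \<Psi>"
  shows "trace (along (L_o L) \<Psi> x ** H) = total_deriv L (jet \<Psi> x) (H, 0, 0, 0, 0)"
    and "trace (along (L_o_star L) \<Psi> x ** H') = total_deriv L (jet \<Psi> x) (0, H', 0, 0, 0)"
    and "trace (along (L_d L \<mu>) \<Psi> x ** H) = total_deriv L (jet \<Psi> x) (0, 0, axis \<mu> H, 0, 0)"
    and "trace (along (L_d_star L \<mu>) \<Psi> x ** H') = total_deriv L (jet \<Psi> x) (0, 0, 0, axis \<mu> H', 0)"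
  by (simp_all add: along_eq_jet[OF \<Psi>] trace_L_o[OF L] trace_L_o_star[OF L] trace_L_d[OF L]
      trace_L_d_star[OF L] split: prod.split)

text \<open>Pairing with a fixed matrix gives the total derivative in a fixed direction, composed
  with the jet; both are differentiable, and the pairings determine the matrix.\<close>

lemma along_L_d_differentiable:
  assumes L: "proto_Lagrangian L" and \<Psi>: "smooth \<Psi>"
  shows "along (L_d L \<mu>) \<Psi> differentiable (at x)" (is ?d)
    and "along (L_d_star L \<mu>) \<Psi> differentiable (at x)" (is ?s)
proof -
  have diff: "(\<lambda>x. total_deriv L (jet \<Psi> x) v) differentiable (at x)" for v
    using total_deriv_differentiable[OF L, of v "jet \<Psi> x"] jet_has_derivative[OF \<Psi>, of x]
    by (auto simp: differentiable_def intro: has_derivative_compose)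
  show ?d ?s
    by (intro differentiable_if_traces, simp add: trace_along[OF L \<Psi>] diff)+
qed

section \<open>The variation of the field\<close>

text \<open>The double sum is the expansion of the derivative of \<Psi> along the vector field
  \<open>A *v x\<close> in coordinates.\<close>

lemma variation_eq:
  assumes "smooth \<Psi>"
  shows "variation K A \<Psi> x = K (\<Psi> x) + frechet_derivative \<Psi> (at x) (A *v x)"
proof -
  note D = smooth_has_derivative[OF assms]
  show ?thesis
    by (subst linear_eq_sum_axis[OF has_derivative_linear[OF D]])
      (simp add: variation_def matrix_vector_mult_def scaleR_sum_left partial_eq[OF D])
qed

text \<open>By the product rule, differentiating the coefficients \<open>x $ \<beta>\<close>
  produces the mixing term of \<open>tuple_op\<close>, while differentiating
  \<open>partial \<alpha> \<Psi>\<close> produces second derivatives, which symmetry turns into the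
  transport of \<open>partial \<mu> \<Psi>\<close> along \<open>A *v x\<close>.\<close>

lemma partial_variation:
  fixes \<Psi> :: "real^'n::finite \<Rightarrow> complex^'c^'r"
  assumes K: "linear K" and \<Psi>: "smooth \<Psi>"
  shows "variation K A \<Psi> differentiable (at x)"
    and "partial \<mu> (variation K A \<Psi>) x
      = tuple_op K A (\<chi> \<mu>. partial \<mu> \<Psi> x) $ \<mu> + frechet_derivative (partial \<mu> \<Psi>) (at x) (A *v x)"
proof -
  have sp: "smooth (partial \<alpha> \<Psi>)" for \<alpha> using \<Psi> by (rule smooth_partial)
  have "bounded_linear K" using K by (simp add: linear_conv_bounded_linear)
  note KD = bounded_linear.has_derivative[OF this smooth_has_derivative[OF \<Psi>]]
  have D: "(variation K A \<Psi> has_derivative (\<lambda>h. K (frechet_derivative \<Psi> (at x) h) +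
      (\<Sum>\<alpha>\<in>UNIV. \<Sum>\<beta>\<in>UNIV. (A $ \<alpha> $ \<beta> * x $ \<beta>) *\<^sub>R frechet_derivative (partial \<alpha> \<Psi>) (at x) h
        + (A $ \<alpha> $ \<beta> * h $ \<beta>) *\<^sub>R partial \<alpha> \<Psi> x))) (at x)"
    unfolding variation_def
    by (intro has_derivative_add KD has_derivative_sum has_derivative_scaleR
        smooth_has_derivative[OF sp] has_derivative_mult_right
        bounded_linear.has_derivative[OF bounded_linear_vec_nth] has_derivative_ident)
  then show "variation K A \<Psi> differentiable (at x)" by (auto simp: differentiable_def)
  have sym: "frechet_derivative (partial \<alpha> \<Psi>) (at x) (axis \<mu> 1)
      = frechet_derivative (partial \<mu> \<Psi>) (at x) (axis \<alpha> 1)" for \<alpha>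
    unfolding partial_eq[OF smooth_has_derivative[OF \<Psi>], abs_def]
    by (rule smooth_frechet_derivative_symmetric[OF \<Psi>])
  have lin: "linear (frechet_derivative (partial \<mu> \<Psi>) (at x))"
    using smooth_has_derivative[OF sp] by (rule has_derivative_linear)
  have "frechet_derivative (partial \<mu> \<Psi>) (at x) (A *v x)
      = (\<Sum>\<alpha>\<in>UNIV. \<Sum>\<beta>\<in>UNIV. (A $ \<alpha> $ \<beta> * x $ \<beta>) *\<^sub>R frechet_derivative (partial \<mu> \<Psi>) (at x) (axis \<alpha> 1))"
    by (subst linear_eq_sum_axis[OF lin]) (simp add: matrix_vector_mult_def scaleR_sum_left)
  \<comment> \<open>Only \<beta> = \<mu> survives, which selects column \<mu> of \<open>A\<close>;
    hence the transposed action in \<open>tuple_op\<close>.\<close>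
  moreover have "(\<Sum>\<alpha>\<in>UNIV. \<Sum>\<beta>\<in>UNIV. (A $ \<alpha> $ \<beta> * axis \<mu> 1 $ \<beta>) *\<^sub>R partial \<alpha> \<Psi> x)
      = (\<Sum>\<alpha>\<in>UNIV. A $ \<alpha> $ \<mu> *\<^sub>R partial \<alpha> \<Psi> x)"
    by (simp add: axis_def if_distrib[of "(*) _"] if_distrib[of "\<lambda>a. a *\<^sub>R _"] cong: if_cong)
  ultimately show "partial \<mu> (variation K A \<Psi>) x
      = tuple_op K A (\<chi> \<mu>. partial \<mu> \<Psi> x) $ \<mu> + frechet_derivative (partial \<mu> \<Psi>) (at x) (A *v x)"
    unfolding partial_eq[OF D] sym
    by (simp add: sum.distrib tuple_op_def partial_eq[OF smooth_has_derivative[OF \<Psi>]])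
qed

section \<open>Collecting trace sums into total derivatives\<close>

text \<open>The Euler-Lagrange equations replace the divergence of the momenta by \<open>L_o\<close>
  and \<open>L_o_star\<close>, whose pairings are derivatives in the first two slots.\<close>

lemma Euler_Lagrange_trace_sum:
  assumes L: "proto_Lagrangian L" and \<Psi>: "smooth \<Psi>" and EL: "Euler_Lagrange L \<Psi>"
  shows "(\<Sum>\<mu>\<in>UNIV. trace (partial \<mu> (along (L_d L \<mu>) \<Psi>) x ** H)) = total_deriv L (jet \<Psi> x) (H, 0, 0, 0, 0)"
    and "(\<Sum>\<mu>\<in>UNIV. trace (partial \<mu> (along (L_d_star L \<mu>) \<Psi>) x ** H')) = total_deriv L (jet \<Psi> x) (0, H', 0, 0, 0)"
proof -
  have "along (L_o L) \<Psi> x = (\<Sum>\<mu>\<in>UNIV. partial \<mu> (along (L_d L \<mu>) \<Psi>) x)"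
    and "along (L_o_star L) \<Psi> x = (\<Sum>\<mu>\<in>UNIV. partial \<mu> (along (L_d_star L \<mu>) \<Psi>) x)"
    using EL by (simp_all add: Euler_Lagrange_def)
  then show "(\<Sum>\<mu>\<in>UNIV. trace (partial \<mu> (along (L_d L \<mu>) \<Psi>) x ** H)) = total_deriv L (jet \<Psi> x) (H, 0, 0, 0, 0)"
    and "(\<Sum>\<mu>\<in>UNIV. trace (partial \<mu> (along (L_d_star L \<mu>) \<Psi>) x ** H')) = total_deriv L (jet \<Psi> x) (0, H', 0, 0, 0)"
    by (simp_all add: bounded_bilinear.sum_left[OF bounded_bilinear_trace_mult, symmetric]
        flip: trace_along[OF L \<Psi>])
qed

text \<open>Each summand is a derivative in one block, and linearity assembles the blocks into a
  tuple.\<close>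

lemma trace_along_L_d_sum:
  assumes L: "proto_Lagrangian L" and \<Psi>: "smooth \<Psi>"
  shows "(\<Sum>\<mu>\<in>UNIV. trace (along (L_d L \<mu>) \<Psi> x ** H \<mu>)) = total_deriv L (jet \<Psi> x) (0, 0, \<chi> \<mu>. H \<mu>, 0, 0)"
    and "(\<Sum>\<mu>\<in>UNIV. trace (along (L_d_star L \<mu>) \<Psi> x ** H' \<mu>)) = total_deriv L (jet \<Psi> x) (0, 0, 0, \<chi> \<mu>. H' \<mu>, 0)"
proof -
  note lin = linear_total_deriv[OF L, of "jet \<Psi> x"]
  have "(\<Sum>\<mu>\<in>UNIV. trace (along (L_d L \<mu>) \<Psi> x ** H \<mu>))
      = (\<Sum>\<mu>\<in>UNIV. total_deriv L (jet \<Psi> x) (0, 0, axis \<mu> (H \<mu>), 0, 0))"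
    by (simp add: trace_along[OF L \<Psi>])
  also have "\<dots> = total_deriv L (jet \<Psi> x) (\<Sum>\<mu>\<in>UNIV. (0, 0, axis \<mu> (H \<mu>), 0, 0))"
    by (rule linear_sum[OF lin, symmetric])
  also have "(\<Sum>\<mu>\<in>UNIV. (0, 0, axis \<mu> (H \<mu>), 0, 0)) = (0, 0, \<chi> \<mu>. H \<mu>, 0, 0)"
    by (simp add: prod_eq_iff fst_sum snd_sum vec_lambda_axis_sum)
  finally show "(\<Sum>\<mu>\<in>UNIV. trace (along (L_d L \<mu>) \<Psi> x ** H \<mu>)) = total_deriv L (jet \<Psi> x) (0, 0, \<chi> \<mu>. H \<mu>, 0, 0)" .
  have "(\<Sum>\<mu>\<in>UNIV. trace (along (L_d_star L \<mu>) \<Psi> x ** H' \<mu>))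
      = (\<Sum>\<mu>\<in>UNIV. total_deriv L (jet \<Psi> x) (0, 0, 0, axis \<mu> (H' \<mu>), 0))"
    by (simp add: trace_along[OF L \<Psi>])
  also have "\<dots> = total_deriv L (jet \<Psi> x) (\<Sum>\<mu>\<in>UNIV. (0, 0, 0, axis \<mu> (H' \<mu>), 0))"
    by (rule linear_sum[OF lin, symmetric])
  also have "(\<Sum>\<mu>\<in>UNIV. (0, 0, 0, axis \<mu> (H' \<mu>), 0)) = (0, 0, 0, \<chi> \<mu>. H' \<mu>, 0)"
    by (simp add: prod_eq_iff fst_sum snd_sum vec_lambda_axis_sum)
  finally show "(\<Sum>\<mu>\<in>UNIV. trace (along (L_d_star L \<mu>) \<Psi> x ** H' \<mu>)) = total_deriv L (jet \<Psi> x) (0, 0, 0, \<chi> \<mu>. H' \<mu>, 0)" .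
qed

lemma partial_differentiable:
  assumes "f differentiable (at x)"
  shows "(f has_derivative frechet_derivative f (at x)) (at x)"
    and "partial \<mu> f x = frechet_derivative f (at x) (axis \<mu> 1)"
  using assms partial_eq by (auto simp: frechet_derivative_works)

section \<open>Divergence of the Noether current\<close>

theorem theorem4p7:
  fixes L :: "('n::finite, 'r::finite, 'c::finite, complex) field_fun"
    and K :: "complex^'c^'r \<Rightarrow> complex^'c^'r"
    and A :: "real^'n^'n"
    and \<Psi> :: "real^'n \<Rightarrow> complex^'c^'r"
  assumes "proto_Lagrangian L"
    and "Vector_Spaces.linear cscale cscale K"
    and "trace A = 0"
    and "internal_symmetry L K A"
    and "external_symmetry L A"
    and "smooth \<Psi>"
    and "Euler_Lagrange L \<Psi>"
  shows "\<forall>x. (\<Sum>\<mu>\<in>UNIV. partial \<mu> (\<lambda>x.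
           trace (along (L_d L \<mu>) \<Psi> x ** variation K A \<Psi> x)
           + trace (along (L_d_star L \<mu>) \<Psi> x ** dagger (variation K A \<Psi> x))
           - (\<Sum>\<beta>\<in>UNIV. complex_of_real (A $ \<mu> $ \<beta> * x $ \<beta>) * along L \<Psi> x)) x) = 0"
proof
  fix x
  note L = assms(1) and \<Psi> = assms(6)
  have K: "linear K" using assms(2) by (rule linear_cscale_imp_linear)
  define M where "M \<mu> = along (L_d L \<mu>) \<Psi>" for \<mu>
  define N where "N \<mu> = along (L_d_star L \<mu>) \<Psi>" for \<mu>
  define v where "v = variation K A \<Psi>"
  define l where "l = along L \<Psi>"
  define D where "D = total_deriv L (jet \<Psi> x)"
  \<comment> \<open>\<open>J h\<close> is the derivative of the jet at \<open>x\<close> in direction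
    \<open>h\<close>; its last component is \<open>h\<close> itself.\<close>
  define J where "J h = (frechet_derivative \<Psi> (at x) h, dagger (frechet_derivative \<Psi> (at x) h),
     \<chi> \<mu>. frechet_derivative (partial \<mu> \<Psi>) (at x) h,
     \<chi> \<mu>. dagger (frechet_derivative (partial \<mu> \<Psi>) (at x) h), h)" for h
  have linD: "linear D"
    unfolding D_def by (rule linear_total_deriv[OF L])
  have M: "M \<mu> differentiable (at x)" and N: "N \<mu> differentiable (at x)" for \<mu>
    unfolding M_def N_def by (rule along_L_d_differentiable[OF L \<Psi>])+
  have v: "v differentiable (at x)"
    unfolding v_def by (rule partial_variation[OF K \<Psi>])
  have J: "(jet \<Psi> has_derivative J) (at x)"
    unfolding J_def by (rule jet_has_derivative[OF \<Psi>])
  have l: "(l has_derivative (\<lambda>h. D (J h))) (at x)"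
    using has_derivative_compose[OF J proto_Lagrangian_has_derivative[OF L]]
    by (simp add: l_def D_def along_eq_jet[OF \<Psi>, abs_def])
  have Dl: "partial \<mu> l x = D (J (axis \<mu> 1))" for \<mu>
    using l by (rule partial_eq)
  have Av: "((\<lambda>y. (A *v y) $ \<mu>) has_derivative (\<lambda>h. (A *v h) $ \<mu>)) (at x)" for \<mu>
    by (intro bounded_linear_imp_has_derivative bounded_linear_compose[OF bounded_linear_vec_nth]
        matrix_vector_mul_bounded_linear)
  \<comment> \<open>The product rule splits each term of the divergence: derivatives of the momenta,
    of the variation, of the Lagrangian density and of the coefficient
    \<open>A *v y\<close>.\<close>
  have partial: "partial \<mu> (\<lambda>y. trace (M \<mu> y ** v y) + trace (N \<mu> y ** dagger (v y))
         - complex_of_real ((A *v y) $ \<mu>) * l y) x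
     = trace (M \<mu> x ** partial \<mu> v x) + trace (partial \<mu> (M \<mu>) x ** v x)
       + (trace (N \<mu> x ** dagger (partial \<mu> v x)) + trace (partial \<mu> (N \<mu>) x ** dagger (v x)))
       - (complex_of_real ((A *v x) $ \<mu>) * partial \<mu> l x
          + complex_of_real ((A *v axis \<mu> 1) $ \<mu>) * l x)" for \<mu>
    unfolding partial_differentiable(2)[OF M] partial_differentiable(2)[OF N]
      partial_differentiable(2)[OF v] Dl
    by (rule partial_eq)
      (intro has_derivative_diff has_derivative_add has_derivative_mult has_derivative_of_real
        bounded_bilinear.FDERIV[OF bounded_bilinear_trace_mult]
        bounded_linear.has_derivative[OF bounded_linear_dagger]
        partial_differentiable(1) M N v l Av)
  have EL: "(\<Sum>\<mu>\<in>UNIV. trace (partial \<mu> (M \<mu>) x ** v x)) = D (v x, 0, 0, 0, 0)"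
    "(\<Sum>\<mu>\<in>UNIV. trace (partial \<mu> (N \<mu>) x ** dagger (v x))) = D (0, dagger (v x), 0, 0, 0)"
    unfolding M_def N_def D_def by (rule Euler_Lagrange_trace_sum[OF L \<Psi> assms(7)])+
  have sums: "(\<Sum>\<mu>\<in>UNIV. trace (M \<mu> x ** partial \<mu> v x)) = D (0, 0, \<chi> \<mu>. partial \<mu> v x, 0, 0)"
    "(\<Sum>\<mu>\<in>UNIV. trace (N \<mu> x ** dagger (partial \<mu> v x))) = D (0, 0, 0, \<chi> \<mu>. dagger (partial \<mu> v x), 0)"
    unfolding M_def N_def D_def by (rule trace_along_L_d_sum[OF L \<Psi>])+
  \<comment> \<open>The \<mu> component of \<open>A *v axis \<mu> 1\<close> is a diagonal entry, so
    the divergence of \<open>A *v x\<close> is the trace.\<close>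
  have "(\<Sum>\<mu>\<in>UNIV. complex_of_real ((A *v axis \<mu> 1) $ \<mu>) * l x) = complex_of_real (trace A) * l x"
    by (simp add: matrix_vector_mult_basis column_def trace_def sum_distrib_right)
  then have tr: "(\<Sum>\<mu>\<in>UNIV. complex_of_real ((A *v axis \<mu> 1) $ \<mu>) * l x) = 0"
    using assms(3) by simp
  have linl: "linear (\<lambda>h. D (J h))" using l by (rule has_derivative_linear)
  have transport: "(\<Sum>\<mu>\<in>UNIV. complex_of_real ((A *v x) $ \<mu>) * partial \<mu> l x) = D (J (A *v x))"
    by (subst linear_eq_sum_axis[OF linl]) (simp add: Dl scaleR_conv_of_real)
  have vx: "v x = K (\<Psi> x) + frechet_derivative \<Psi> (at x) (A *v x)"
    unfolding v_def by (rule variation_eq[OF \<Psi>])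
  have pv: "partial \<mu> v x = tuple_op K A (\<chi> \<mu>. partial \<mu> \<Psi> x) $ \<mu>
      + frechet_derivative (partial \<mu> \<Psi>) (at x) (A *v x)" for \<mu>
    unfolding v_def by (rule partial_variation[OF K \<Psi>])
  let ?Q = "tuple_op K A (\<chi> \<mu>. partial \<mu> \<Psi> x)"
  have dagger_add: "dagger (Y + Z) = dagger Y + dagger Z" for Y Z :: "complex^'c^'r"
    by (rule linear_add[OF bounded_linear.linear[OF bounded_linear_dagger]])
  have "D (v x, 0, 0, 0, 0) + D (0, dagger (v x), 0, 0, 0) + D (0, 0, \<chi> \<mu>. partial \<mu> v x, 0, 0)
      + D (0, 0, 0, \<chi> \<mu>. dagger (partial \<mu> v x), 0)
      = D (v x, dagger (v x), \<chi> \<mu>. partial \<mu> v x, \<chi> \<mu>. dagger (partial \<mu> v x), 0)"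
    by (simp flip: linear_add[OF linD])
  \<comment> \<open>The first tuple generates the internal symmetry. Subtracting
    \<open>A *v x\<close> in the last slot of \<open>J (A *v x)\<close> is needed because the
    direction on the left leaves the base point fixed.\<close>
  also have "(v x, dagger (v x), \<chi> \<mu>. partial \<mu> v x, \<chi> \<mu>. dagger (partial \<mu> v x), 0)
      = (K (\<Psi> x), dagger (K (\<Psi> x)), ?Q, \<chi> \<mu>. dagger (?Q $ \<mu>), 0)
        + (J (A *v x) - (0, 0, 0, 0, A *v x))"
    by (simp add: J_def vx pv dagger_add vec_eq_iff)
  \<comment> \<open>The internal generator and the subtracted external one are both annihilated by
    \<open>D\<close>.\<close>
  also have "D \<dots> = D (J (A *v x))"
    using internal_symmetry_infinitesimal[OF L K assms(4), of "\<Psi> x" "\<chi> \<mu>. partial \<mu> \<Psi> x" x]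
      external_symmetry_infinitesimal[OF L assms(5), of "\<Psi> x" "\<chi> \<mu>. partial \<mu> \<Psi> x" x]
    by (simp add: linear_add[OF linD] linear_diff[OF linD]) (simp add: D_def jet_def)
  finally have main: "D (v x, 0, 0, 0, 0) + D (0, dagger (v x), 0, 0, 0) + D (0, 0, \<chi> \<mu>. partial \<mu> v x, 0, 0)
      + D (0, 0, 0, \<chi> \<mu>. dagger (partial \<mu> v x), 0) = D (J (A *v x))" .
  have current: "(\<Sum>\<beta>\<in>UNIV. complex_of_real (A $ \<mu> $ \<beta> * y $ \<beta>) * along L \<Psi> y)
      = complex_of_real ((A *v y) $ \<mu>) * l y" for \<mu> y
    by (simp add: l_def matrix_vector_mult_def sum_distrib_right)
  show "(\<Sum>\<mu>\<in>UNIV. partial \<mu> (\<lambda>x.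
           trace (along (L_d L \<mu>) \<Psi> x ** variation K A \<Psi> x)
           + trace (along (L_d_star L \<mu>) \<Psi> x ** dagger (variation K A \<Psi> x))
           - (\<Sum>\<beta>\<in>UNIV. complex_of_real (A $ \<mu> $ \<beta> * x $ \<beta>) * along L \<Psi> x)) x) = 0"
    unfolding current M_def[symmetric] N_def[symmetric] v_def[symmetric] partial
      sum_subtractf sum.distrib EL sums tr transport
    using main by (simp add: algebra_simps)
qed

end
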